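(* For every $\varepsilon>0$ there exists $b_0$ such that for every instance $G$ of the vertex-weighted online $b$-matching problem with stochastic rewards with individual server capacities $b_s$ satisfying $b_{\min}:=\min_{s\in S}b_s\ge b_0$, arbitrary edge probabilities $p_{s,r}\in(0,1]$ and arbitrary server weights $w_s\ge 0$, the generalized \textsc{StochasticBalance} algorithm satisfies $\mathbb{E}[\textsc{SBal}(G)]\ge(1-1/e-\varepsilon)\cdot\textsc{Opt}(G)$ and $\mathbb{E}[\textsc{SBal}(G)]\ge(1-1/e-\varepsilon)\cdot\textsc{SOpt}(G)$. That is, \textsc{StochasticBalance} is $(1-1/e)$-competitive against both benchmarks as $b_{\min}\to\infty$.
   Context: Vertex-weighted online $b$-matching with stochastic rewards: a bipartite graph $G=(S\cup R,E)$, servers $S$ known in advance; server $s$ has capacity $b_s$ (maximum number of successful matches) and weight $w_s$. Requests $r\in R$ arrive online; on arrival its incident edges and probabilities $p_{s,r}\in(0,1]$ are revealed, and the algorithm must immediately and irrevocably assign $r$ to a neighbor with remaining capacity or leave it unassigned. An assignment of $r$ to $s$ succeeds with probability $p_{s,r}$ independently; a success uses one unit of capacity of $s$ and yields value $w_s$, a failure does not use capacity. The objective is the expected total weight of successful matches; $\mathbb{E}[\textsc{SBal}(G)]$ denotes this for the algorithm below. The load $l_s$ is the sum of $p_{s,r'}$ over requests $r'$ assigned to $s$ so far (successful or not). For each server let $f_s(x)=e^{x/b_s-1}$ for $x\le b_s$ and $f_s(x)=1$ for $x>b_s$. Generalized \textsc{StochasticBalance}: when $r$ arrives, let $N(r)$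 be its neighbors with remaining capacity; if empty leave $r$ unassigned, else assign $r$ to a server in $\arg\max\{w_s p_{s,r}(1-f_s(l_s)):s\in N(r)\}$ (ties broken arbitrarily). $\textsc{Opt}(G)$ is the optimal value of the LP: maximize $\sum_{\{s,r\}\in E}p_{s,r}w_s m(s,r)$ s.t. $\sum_r p_{s,r}m(s,r)\le b_s$ for all $s$, $\sum_s m(s,r)\le 1$ for all $r$, $m\ge 0$. $\textsc{SOpt}(G)$ is the expected total weight of matches of an optimal algorithm that knows the whole graph, weights and probabilities in advance but must assign requests in arrival order and only learns the success of an assignment after making it. *)

theory Defs
  imports "HOL-Probability.Probability_Mass_Function"
begin

text \<open>
  Requests are identified with their arrival positions \<open>0, ..., num_requests - 1\<close>. Servers are
  named by natural numbers rather than by elements of a type parameter: every finite instance is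
  isomorphic to one of this form, and a bound that is uniform over all instances (such as
  \<open>b\<^sub>0\<close>) then cannot depend on the choice of a type.
\<close>

record bmatching =
  servers :: "nat set"
  num_requests :: nat
  edges :: "(nat \<times> nat) set"
  capacity :: "nat \<Rightarrow> nat"
  weight :: "nat \<Rightarrow> real"
  eprob :: "nat \<Rightarrow> nat \<Rightarrow> real"

definition valid_instance :: "bmatching \<Rightarrow> bool" where
  "valid_instance G \<longleftrightarrow>
     finite (servers G) \<and> servers G \<noteq> {} \<and>
     edges G \<subseteq> servers G \<times> {..<num_requests G} \<and>
     (\<forall>s\<in>servers G. 0 < capacity G s \<and> 0 \<le> weight G s) \<and>
     (\<forall>(s, r)\<in>edges G. 0 < eprob G s r \<and> eprob G s r \<le> 1)"

definition b_min :: "bmatching \<Rightarrow> nat" where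
  "b_min G = Min (capacity G ` servers G)"

text \<open>
  A history lists what happened to the requests that have arrived so far, in order of arrival:
  \<open>None\<close> if the request was left unassigned, \<open>Some (s, ok)\<close> if it was assigned to \<open>s\<close> with
  success \<open>ok\<close>. The request arriving after history \<open>h\<close> is thus \<open>length h\<close>.
\<close>

type_synonym history = "(nat \<times> bool) option list"

definition successes :: "history \<Rightarrow> nat \<Rightarrow> nat" where
  "successes h s = count_list h (Some (s, True))"

definition load :: "bmatching \<Rightarrow> history \<Rightarrow> nat \<Rightarrow> real" where
  "load G h s = (\<Sum>i | i < length h \<and> (\<exists>ok. h ! i = Some (s, ok)). eprob G s i)"

definition available :: "bmatching \<Rightarrow> history \<Rightarrow> nat set" where
  "available G h =
     {s \<in> servers G. (s, length h) \<in> edges G \<and> successes h s < capacity G s}"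

text \<open>
  A (possibly randomized, adaptive) assignment policy chooses, from the history so far, the server
  for the next request, or \<open>None\<close> to leave it unassigned. It may depend on the instance in an
  arbitrary way, including on requests that have not arrived yet.
\<close>

type_synonym policy = "history \<Rightarrow> nat option pmf"

definition feasible_policy :: "bmatching \<Rightarrow> policy \<Rightarrow> bool" where
  "feasible_policy G \<pi> \<longleftrightarrow>
     (\<forall>h. length h < num_requests G \<longrightarrow>
        set_pmf (\<pi> h) \<subseteq> insert None (Some ` available G h))"

fun run :: "bmatching \<Rightarrow> policy \<Rightarrow> nat \<Rightarrow> history pmf" where
  "run G \<pi> 0 = return_pmf []"
| "run G \<pi> (Suc k) =
     bind_pmf (run G \<pi> k) (\<lambda>h. bind_pmf (\<pi> h) (\<lambda>a.
       case a of
         None \<Rightarrow> return_pmf (h @ [None])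
       | Some s \<Rightarrow> map_pmf (\<lambda>ok. h @ [Some (s, ok)]) (bernoulli_pmf (eprob G s k))))"

definition matched_weight :: "bmatching \<Rightarrow> history \<Rightarrow> real" where
  "matched_weight G h = (\<Sum>s\<in>servers G. weight G s * real (successes h s))"

definition expected_weight :: "bmatching \<Rightarrow> policy \<Rightarrow> real" where
  "expected_weight G \<pi> =
     measure_pmf.expectation (run G \<pi> (num_requests G)) (matched_weight G)"

definition penalty :: "bmatching \<Rightarrow> nat \<Rightarrow> real \<Rightarrow> real" where
  "penalty G s x =
     (if x \<le> real (capacity G s) then exp (x / real (capacity G s) - 1) else 1)"

text \<open>
  Arbitrary tie-breaking: a policy is an implementation of StochasticBalance if it only ever
  chooses maximizers; the choice among them may be randomized and depend on the history.
\<close>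

definition stochastic_balance :: "bmatching \<Rightarrow> policy \<Rightarrow> bool" where
  "stochastic_balance G \<pi> \<longleftrightarrow>
     (\<forall>h. length h < num_requests G \<longrightarrow>
        (if available G h = {} then \<pi> h = return_pmf None
         else set_pmf (\<pi> h) \<subseteq>
           Some ` {s. is_arg_max
             (\<lambda>s. weight G s * eprob G s (length h) * (1 - penalty G s (load G h s)))
             (\<lambda>s. s \<in> available G h) s}))"

definition lp_feasible :: "bmatching \<Rightarrow> (nat \<Rightarrow> nat \<Rightarrow> real) \<Rightarrow> bool" where
  "lp_feasible G m \<longleftrightarrow>
     (\<forall>s\<in>servers G. (\<Sum>r | (s, r) \<in> edges G. eprob G s r * m s r) \<le> real (capacity G s)) \<and>
     (\<forall>r<num_requests G. (\<Sum>s | (s, r) \<in> edges G. m s r) \<le> 1) \<and>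
     (\<forall>(s, r)\<in>edges G. 0 \<le> m s r)"

definition lp_objective :: "bmatching \<Rightarrow> (nat \<Rightarrow> nat \<Rightarrow> real) \<Rightarrow> real" where
  "lp_objective G m = (\<Sum>(s, r)\<in>edges G. eprob G s r * weight G s * m s r)"

text \<open>
  For valid instances both suprema below range over nonempty sets that are bounded above.
\<close>

definition Opt :: "bmatching \<Rightarrow> real" where
  "Opt G = (SUP m \<in> {m. lp_feasible G m}. lp_objective G m)"

definition SOpt :: "bmatching \<Rightarrow> real" where
  "SOpt G = (SUP \<pi> \<in> {\<pi>. feasible_policy G \<pi>}. expected_weight G \<pi>)"

end

(*
  Online primal-dual argument. Let f be the penalty function, X_s the number of successes and L_s the
  load of server s at the end of a run. Assigning a request r to s at load l gives its dual variable
  the value w_s p (1 - f l); server s gets w_s (f L_s - 1/e), or w_s (1 - 1/e) if it is full. By the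
  greedy choice these duals satisfy every LP constraint up to the factor 1 - 1/e on every run, not only
  in expectation. Their cost is bounded by the sum of w_s L_s, up to a factor 1 + 1/b_s and an error
  for full servers. As X_s - L_s is a martingale, E X_s = E L_s and E (X_s - L_s)^2 <= E X_s, so the
  error is at most w_s E X_s / sqrt b_s. A policy that knows the whole instance is bounded by the LP
  through its assignment probabilities.
*)

theory Submission
  imports Defs
begin

section \<open>Increments of the penalty function\<close>

lemma penalty_eq_exp:
  assumes "0 < capacity G s"
  shows "penalty G s x = exp (min (x / real (capacity G s)) 1 - 1)"
  using assms by (auto simp: penalty_def min_def field_simps)

lemma penalty_le_1:
  assumes "0 < capacity G s"
  shows "penalty G s x \<le> 1"
  by (simp add: penalty_eq_exp[OF assms])

lemma penalty_mono:
  assumes "0 < capacity G s" "x \<le> y"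
  shows "penalty G s x \<le> penalty G s y"
proof -
  have "x / real (capacity G s) \<le> y / real (capacity G s)"
    using assms by (simp add: divide_right_mono)
  then show ?thesis by (auto simp: penalty_eq_exp[OF assms(1)])
qed

text \<open>A discrete form of \<open>b f' \<le> f\<close>: the tangent of exp bounds its increment,
  and clipping at 1 never enlarges the difference of the exponents. By convexity the value on the
  right is taken at the new load, not the old one.\<close>

lemma penalty_increment:
  assumes b: "0 < capacity G s" and d: "0 \<le> d"
  shows "real (capacity G s) * (penalty G s (x + d) - penalty G s x) \<le> d * penalty G s (x + d)"
proof -
  let ?b = "real (capacity G s)"
  define u v where "u = min (x / ?b) 1 - 1" and "v = min ((x + d) / ?b) 1 - 1"
  have "0 \<le> d / ?b" using b d by simp
  then have vu: "v - u \<le> d / ?b"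
    by (auto simp: u_def v_def min_def add_divide_distrib)
  \<comment> \<open>The tangent to exp at \<open>v\<close> lies below exp at
    \<open>u\<close>.\<close>
  have "exp v * (1 + (u - v)) \<le> exp v * exp (u - v)"
    by (intro mult_left_mono exp_ge_add_one_self) auto
  then have "exp v - exp u \<le> (v - u) * exp v"
    by (simp add: mult_exp_exp algebra_simps)
  also have "\<dots> \<le> d / ?b * exp v"
    using vu by (intro mult_right_mono) auto
  finally have "?b * (exp v - exp u) \<le> ?b * (d / ?b * exp v)"
    using b by (intro mult_left_mono) auto
  then show ?thesis
    using b by (simp add: penalty_eq_exp[OF b] u_def v_def)
qed

lemma penalty_lipschitz:
  assumes "0 < capacity G s" "0 \<le> d"
  shows "real (capacity G s) * (penalty G s (x + d) - penalty G s x) \<le> d"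
  using penalty_increment[OF assms, of x] mult_left_mono[OF penalty_le_1[OF assms(1)] assms(2)]
  by (metis mult.right_neutral order_trans)

section \<open>Histories and induction along a run\<close>

lemma successes_Nil [simp]: "successes [] s = 0"
  by (simp add: successes_def)

lemma successes_snoc:
  "successes (h @ [a]) s = successes h s + (if a = Some (s, True) then 1 else 0)"
  by (simp add: successes_def)

lemma load_eq_sum:
  "load G h s = (\<Sum>i<length h. if \<exists>ok. h ! i = Some (s, ok) then eprob G s i else 0)"
  unfolding load_def
  by (simp add: sum.inter_filter[symmetric])

lemma load_Nil [simp]: "load G [] s = 0"
  by (simp add: load_eq_sum)

lemma load_snoc:
  "load G (h @ [a]) s =
     load G h s + (if \<exists>ok. a = Some (s, ok) then eprob G s (length h) else 0)"
  by (simp add: load_eq_sum nth_append)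

text \<open>For invariants of every possible run, independent of probabilities. The length is part
  of the conclusion because the index of the arriving request is \<open>length h\<close>.\<close>

lemma set_run_induct [consumes 1, case_names Nil None Some]:
  assumes "h \<in> set_pmf (run G \<pi> k)"
    and "P []"
    and "\<And>h. length h < k \<Longrightarrow> P h \<Longrightarrow> None \<in> set_pmf (\<pi> h) \<Longrightarrow> P (h @ [None])"
    and "\<And>h s ok. length h < k \<Longrightarrow> P h \<Longrightarrow> Some s \<in> set_pmf (\<pi> h) \<Longrightarrow> P (h @ [Some (s, ok)])"
  shows "length h = k \<and> P h"
  using assms
proof (induction k arbitrary: h)
  case 0
  then show ?case by simp
next
  case (Suc k)
  from Suc.prems(1) obtain h' a where h': "h' \<in> set_pmf (run G \<pi> k)" and a: "a \<in> set_pmf (\<pi> h')"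
    and h: "h \<in> set_pmf (case a of None \<Rightarrow> return_pmf (h' @ [None])
       | Some s \<Rightarrow> map_pmf (\<lambda>ok. h' @ [Some (s, ok)]) (bernoulli_pmf (eprob G s k)))"
    by auto
  have IH: "length h' = k \<and> P h'"
    using h' Suc.prems by (intro Suc.IH) (auto simp: less_Suc_eq)
  show ?case
    using IH a h Suc.prems(3,4) by (cases a) auto
qed

lemma length_run: "h \<in> set_pmf (run G \<pi> k) \<Longrightarrow> length h = k"
  by (drule set_run_induct[where P = "\<lambda>_. True"]) auto

section \<open>Dual variables of a history\<close>

text \<open>The prefix \<open>take i h\<close> fixes the load seen on arrival of request
  \<open>i\<close>, so later arrivals leave the value unchanged. The weight is left out so that
  costs can be estimated for each server separately.\<close>

definition charge :: "bmatching \<Rightarrow> history \<Rightarrow> nat \<Rightarrow> nat \<Rightarrow> real" where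
  "charge G h s i =
     (if \<exists>ok. h ! i = Some (s, ok) then eprob G s i * (1 - penalty G s (load G (take i h) s)) else 0)"

lemma charge_append: "i < length h \<Longrightarrow> charge G (h @ h') s i = charge G h s i"
  by (simp add: charge_def nth_append)

lemma charge_snoc:
  "charge G (h @ [a]) s (length h) =
     (if \<exists>ok. a = Some (s, ok) then eprob G s (length h) * (1 - penalty G s (load G h s)) else 0)"
  by (simp add: charge_def)

text \<open>The LP dual variable of \<open>s\<close> divided by \<open>weight G s\<close>.
  Subtracting \<open>exp (-1)\<close>, the penalty at load 0, makes it start at 0.\<close>

definition server_dual :: "bmatching \<Rightarrow> history \<Rightarrow> nat \<Rightarrow> real" where
  "server_dual G h s =
     (if capacity G s \<le> successes h s then 1 else penalty G s (load G h s)) - exp (-1)"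

text \<open>At most one summand is nonzero. The form as a sum over servers lets the total over all
  requests be regrouped by server.\<close>

definition request_dual :: "bmatching \<Rightarrow> history \<Rightarrow> nat \<Rightarrow> real" where
  "request_dual G h i = (\<Sum>s\<in>servers G. weight G s * charge G h s i)"

section \<open>Expectations over runs of a feasible policy\<close>

text \<open>The policy is any feasible one, so the results apply both to StochasticBalance and to
  the policies that \<open>SOpt\<close> ranges over.\<close>

locale bmatching_policy =
  fixes G :: bmatching and \<pi> :: policy
  assumes valid: "valid_instance G" and feasible: "feasible_policy G \<pi>"
begin

lemma finite_servers [simp, intro]: "finite (servers G)"
  using valid by (simp add: valid_instance_def)

lemma finite_edges [simp, intro]: "finite (edges G)"
  by (rule finite_subset[of _ "servers G \<times> {..<num_requests G}"])
     (use valid in \<open>auto simp: valid_instance_def\<close>)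

lemma edge_D:
  assumes "(s, r) \<in> edges G"
  shows "s \<in> servers G" "r < num_requests G" "0 < eprob G s r" "eprob G s r \<le> 1"
  using assms valid by (auto simp: valid_instance_def)

lemma server_D:
  assumes "s \<in> servers G"
  shows "0 < capacity G s" "0 \<le> weight G s"
  using assms valid by (auto simp: valid_instance_def)

lemma policy_available:
  assumes "Some s \<in> set_pmf (\<pi> h)" "length h < num_requests G"
  shows "s \<in> available G h"
  using assms feasible by (fastforce simp: feasible_policy_def)

lemma available_D:
  assumes "s \<in> available G h"
  shows "s \<in> servers G" "(s, length h) \<in> edges G" "successes h s < capacity G s"
  using assms by (auto simp: available_def)

lemma finite_set_policy:
  assumes "length h < num_requests G"
  shows "finite (set_pmf (\<pi> h))"
proof (rule finite_subset)
  show "set_pmf (\<pi> h) \<subseteq> insert None (Some ` available G h)"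
    using assms feasible by (simp add: feasible_policy_def)
  show "finite (insert None (Some ` available G h))"
    by (simp add: available_def)
qed

text \<open>Each step has finitely many choices and outcomes. All expectations are thus finite sums,
  and every real function of the history is integrable.\<close>

lemma finite_set_run:
  "k \<le> num_requests G \<Longrightarrow> finite (set_pmf (run G \<pi> k))"
proof (induction k)
  case (Suc k)
  then show ?case
    by (auto simp: finite_set_policy length_run split: option.split)
qed simp

lemma integrable_run [simp, intro]:
  fixes g :: "history \<Rightarrow> real"
  shows "integrable (measure_pmf (run G \<pi> (num_requests G))) g"
  by (intro integrable_measure_pmf_finite finite_set_run) simp

text \<open>The one-step bound holds for each possible choice, hence also after averaging over a
  randomized one; induction on arrivals does the rest. A martingale is treated by applying this to
  \<open>g\<close> and to its negative.\<close>

lemma expectation_run_supermartingale: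
  fixes g :: "history \<Rightarrow> real"
  assumes none: "\<And>h. g (h @ [None]) \<le> g h"
    and some: "\<And>h s. s \<in> available G h \<Longrightarrow>
      eprob G s (length h) * g (h @ [Some (s, True)]) +
      (1 - eprob G s (length h)) * g (h @ [Some (s, False)]) \<le> g h"
    and "k \<le> num_requests G"
  shows "measure_pmf.expectation (run G \<pi> k) g \<le> g []"
  using \<open>k \<le> num_requests G\<close>
proof (induction k)
  case (Suc k)
  define D where "D h a = (case a of None \<Rightarrow> return_pmf (h @ [None])
       | Some s \<Rightarrow> map_pmf (\<lambda>ok. h @ [Some (s, ok)]) (bernoulli_pmf (eprob G s k)))"
    for h and a :: "nat option"
  have D_finite: "finite (set_pmf (D h a))" for h a
    by (auto simp: D_def split: option.split)
  have fin: "finite (set_pmf (run G \<pi> k))"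
    using Suc.prems by (intro finite_set_run) simp
  have step: "measure_pmf.expectation (bind_pmf (\<pi> h) (D h)) g \<le> g h"
    if h: "h \<in> set_pmf (run G \<pi> k)" for h
  proof -
    have len: "length h = k" using h by (rule length_run)
    then have fin\<pi>: "finite (set_pmf (\<pi> h))"
      using Suc.prems by (intro finite_set_policy) simp
    have "measure_pmf.expectation (D h a) g \<le> g h" if a: "a \<in> set_pmf (\<pi> h)" for a
    proof (cases a)
      case None
      then show ?thesis using none by (simp add: D_def)
    next
      case (Some s)
      then have s: "s \<in> available G h"
        using a len Suc.prems by (intro policy_available) auto
      then show ?thesis
        using some[OF s] edge_D[OF available_D(2)[OF s]] len
        by (simp add: D_def Some algebra_simps)
    qed
    then have "(\<Sum>a\<in>set_pmf (\<pi> h). pmf (\<pi> h) a * measure_pmf.expectation (D h a) g)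
        \<le> (\<Sum>a\<in>set_pmf (\<pi> h). pmf (\<pi> h) a * g h)"
      by (intro sum_mono mult_left_mono) auto
    also have "\<dots> = g h"
      using fin\<pi> by (simp add: sum_distrib_right[symmetric] sum_pmf_eq_1)
    finally show ?thesis
      using fin\<pi> D_finite by (subst pmf_expectation_bind[of "set_pmf (\<pi> h)"]) auto
  qed
  have "measure_pmf.expectation (run G \<pi> (Suc k)) g =
      measure_pmf.expectation (bind_pmf (run G \<pi> k) (\<lambda>h. bind_pmf (\<pi> h) (D h))) g"
    by (simp add: D_def[abs_def])
  also have "\<dots> = (\<Sum>h\<in>set_pmf (run G \<pi> k).
      pmf (run G \<pi> k) h * measure_pmf.expectation (bind_pmf (\<pi> h) (D h)) g)"
    using fin D_finite Suc.prems
    by (subst pmf_expectation_bind[of "set_pmf (run G \<pi> k)"]) (auto simp: length_run intro!: finite_set_policy)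
  also have "\<dots> \<le> (\<Sum>h\<in>set_pmf (run G \<pi> k). pmf (run G \<pi> k) h * g h)"
    using step by (intro sum_mono mult_left_mono) auto
  also have "\<dots> = measure_pmf.expectation (run G \<pi> k) g"
    using fin by (subst integral_measure_pmf[of "set_pmf (run G \<pi> k)"]) auto
  also have "\<dots> \<le> g []"
    using Suc by simp
  finally show ?case .
qed simp

abbreviation E :: "(history \<Rightarrow> real) \<Rightarrow> real" where
  "E \<equiv> measure_pmf.expectation (run G \<pi> (num_requests G))"

text \<open>An assignment with probability p changes successes minus load by 1 - p with probability
  p and by -p otherwise, which is 0 on average.\<close>

lemma expectation_load: "E (\<lambda>h. load G h s) = E (\<lambda>h. real (successes h s))"
proof (rule antisym)
  have "E (\<lambda>h. load G h s - real (successes h s)) \<le> load G [] s - real (successes [] s)"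
    by (rule expectation_run_supermartingale) (auto simp: load_snoc successes_snoc algebra_simps)
  then show "E (\<lambda>h. load G h s) \<le> E (\<lambda>h. real (successes h s))" by simp
  have "E (\<lambda>h. real (successes h s) - load G h s) \<le> real (successes [] s) - load G [] s"
    by (rule expectation_run_supermartingale) (auto simp: load_snoc successes_snoc algebra_simps)
  then show "E (\<lambda>h. real (successes h s)) \<le> E (\<lambda>h. load G h s)" by simp
qed

text \<open>The increment of successes minus load has mean 0 and variance p (1 - p) \<le> p, so its
  square minus the load is a supermartingale. The expected load is then replaced by the expected
  successes.\<close>

lemma expectation_deviation:
  "E (\<lambda>h. (real (successes h s) - load G h s)\<^sup>2) \<le> E (\<lambda>h. real (successes h s))"
proof -
  have "E (\<lambda>h. (real (successes h s) - load G h s)\<^sup>2 - load G h s)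
      \<le> (real (successes [] s) - load G [] s)\<^sup>2 - load G [] s"
    by (rule expectation_run_supermartingale)
       (auto simp: load_snoc successes_snoc power2_eq_square algebra_simps)
  then show ?thesis by (simp add: expectation_load)
qed

lemma run_edges:
  assumes "h \<in> set_pmf (run G \<pi> k)" "k \<le> num_requests G"
  shows "\<forall>i<length h. \<forall>s ok. h ! i = Some (s, ok) \<longrightarrow> (s, i) \<in> edges G"
proof -
  have "length h = k \<and> (\<forall>i<length h. \<forall>s ok. h ! i = Some (s, ok) \<longrightarrow> (s, i) \<in> edges G)"
    using assms(1)
  proof (induction rule: set_run_induct)
    case (Some h s ok)
    then have "(s, length h) \<in> edges G"
      using assms(2) by (intro available_D(2) policy_available) auto
    with Some show ?case by (auto simp: nth_append less_Suc_eq)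
  qed (auto simp: nth_append less_Suc_eq)
  then show ?thesis by blast
qed

lemma successes_le_capacity:
  assumes "h \<in> set_pmf (run G \<pi> k)" "k \<le> num_requests G"
  shows "successes h s \<le> capacity G s"
proof -
  have "length h = k \<and> successes h s \<le> capacity G s"
    using assms(1)
  proof (induction rule: set_run_induct)
    case (Some h t ok)
    then have "successes h t < capacity G t"
      using assms(2) by (intro available_D(3) policy_available) auto
    with Some show ?case by (auto simp: successes_snoc)
  qed (auto simp: successes_snoc)
  then show ?thesis by blast
qed

section \<open>Assignment probabilities as an LP solution\<close>

lemma expected_weight_eq:
  "expected_weight G \<pi> = (\<Sum>s\<in>servers G. weight G s * E (\<lambda>h. real (successes h s)))"
  by (simp add: expected_weight_def matched_weight_def[abs_def])

lemma expected_weight_nonneg: "0 \<le> expected_weight G \<pi>"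
  unfolding expected_weight_eq
  by (intro sum_nonneg mult_nonneg_nonneg Bochner_Integration.integral_nonneg) (auto simp: server_D)

lemma lp_objective_eq:
  "lp_objective G m =
     (\<Sum>s\<in>servers G. weight G s * (\<Sum>r | (s, r) \<in> edges G. eprob G s r * m s r))"
proof -
  have edges: "Sigma (servers G) (\<lambda>s. {r. (s, r) \<in> edges G}) = edges G"
    using edge_D by auto
  have "\<forall>s\<in>servers G. finite {r. (s, r) \<in> edges G}"
    by (rule ballI, rule finite_subset[of _ "{..<num_requests G}"]) (auto dest: edge_D)
  from sum.Sigma[OF finite_servers this, of "\<lambda>s r. eprob G s r * weight G s * m s r"]
  have "lp_objective G m =
      (\<Sum>s\<in>servers G. \<Sum>r | (s, r) \<in> edges G. eprob G s r * weight G s * m s r)"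
    by (simp only: edges lp_objective_def)
  then show ?thesis by (simp add: sum_distrib_left mult_ac)
qed

lemma lp_objective_le:
  assumes "lp_feasible G m"
  shows "lp_objective G m \<le> (\<Sum>s\<in>servers G. weight G s * real (capacity G s))"
  unfolding lp_objective_eq
  using assms by (intro sum_mono mult_left_mono) (auto simp: lp_feasible_def server_D)

text \<open>The witness is the probability that \<open>r\<close> is assigned to \<open>s\<close>.
  Capacities bound successes on every run but loads only in expectation; the LP constraint follows
  since both have the same mean.\<close>

lemma lp_solution_of_policy:
  "\<exists>m. lp_feasible G m \<and> lp_objective G m = expected_weight G \<pi>"
proof -
  \<comment> \<open>\<open>I s r\<close> indicates that the history assigns \<open>r\<close> to
    \<open>s\<close>.\<close>
  define I where "I s r h = (if \<exists>ok. h ! r = Some (s, ok) then 1 else 0 :: real)"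
    for s r and h :: history
  define m where "m s r = E (I s r)" for s r
  have supp: "length h = num_requests G" "\<And>i s ok. i < num_requests G \<Longrightarrow> h ! i = Some (s, ok) \<Longrightarrow> (s, i) \<in> edges G"
    if "h \<in> set_pmf (run G \<pi> (num_requests G))" for h
    using length_run[OF that] run_edges[OF that] by auto
  have load: "(\<Sum>r | (s, r) \<in> edges G. eprob G s r * m s r) = E (\<lambda>h. real (successes h s))" for s
  proof -
    have "(\<Sum>r | (s, r) \<in> edges G. eprob G s r * m s r) =
        E (\<lambda>h. \<Sum>r | (s, r) \<in> edges G. eprob G s r * I s r h)"
      by (simp add: m_def)
    also have "\<dots> = E (\<lambda>h. load G h s)"
    proof (intro integral_cong_AE AE_pmfI)
      fix h assume h: "h \<in> set_pmf (run G \<pi> (num_requests G))"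
      show "(\<Sum>r | (s, r) \<in> edges G. eprob G s r * I s r h) = load G h s"
        unfolding load_eq_sum
        by (rule sum.mono_neutral_cong_left) (auto simp: I_def supp[OF h] dest: edge_D)
    qed auto
    finally show ?thesis by (simp add: expectation_load)
  qed
  have "lp_feasible G m"
    unfolding lp_feasible_def
  proof (intro conjI ballI allI impI)
    fix s
    have "E (\<lambda>h. real (successes h s)) \<le> E (\<lambda>h. real (capacity G s))"
      by (intro integral_mono_AE AE_pmfI) (auto simp: successes_le_capacity)
    then show "(\<Sum>r | (s, r) \<in> edges G. eprob G s r * m s r) \<le> real (capacity G s)"
      by (simp add: load)
  next
    fix r assume "r < num_requests G"
    have fin: "finite {s. (s, r) \<in> edges G}"
      by (rule finite_subset[of _ "servers G"]) (auto dest: edge_D)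
    have le: "(\<Sum>s | (s, r) \<in> edges G. I s r h) \<le> 1" for h
    proof (cases "h ! r")
      case (Some a)
      obtain t ok where "a = (t, ok)" by (cases a)
      with Some have "(\<Sum>s | (s, r) \<in> edges G. I s r h) =
          (\<Sum>s | (s, r) \<in> edges G. if s = t then 1 else 0)"
        by (intro sum.cong) (auto simp: I_def)
      also have "\<dots> \<le> 1" using fin by simp
      finally show ?thesis .
    qed (simp add: I_def)
    have "(\<Sum>s | (s, r) \<in> edges G. m s r) = E (\<lambda>h. \<Sum>s | (s, r) \<in> edges G. I s r h)"
      by (simp add: m_def)
    also have "\<dots> \<le> E (\<lambda>h. 1)"
      by (intro integral_mono le) auto
    finally show "(\<Sum>s | (s, r) \<in> edges G. m s r) \<le> 1" by simp
  next
    show "case x of (s, r) \<Rightarrow> 0 \<le> m s r" for x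
      by (cases x) (auto simp: m_def I_def intro!: Bochner_Integration.integral_nonneg)
  qed
  moreover have "lp_objective G m = expected_weight G \<pi>"
    by (simp add: lp_objective_eq load expected_weight_eq)
  ultimately show ?thesis by blast
qed

section \<open>Amortized cost of the duals of one server\<close>

text \<open>Assigning at load l with probability p raises the left side by at most p f(l + p) + p (1
  - f(l)), where f is the penalty. This is p plus p times an increment of f, hence at most p (1 +
  1/b).\<close>

lemma server_potential:
  assumes "h \<in> set_pmf (run G \<pi> k)" "k \<le> num_requests G" and s: "s \<in> servers G"
  shows "real (capacity G s) * (penalty G s (load G h s) - exp (-1)) + (\<Sum>i<length h. charge G h s i)
     \<le> load G h s * (1 + 1 / real (capacity G s))"
proof -
  let ?b = "real (capacity G s)"
  have b: "0 < capacity G s" using s by (rule server_D)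
  have "length h = k \<and> ?b * (penalty G s (load G h s) - exp (-1)) + (\<Sum>i<length h. charge G h s i)
     \<le> load G h s * (1 + 1 / ?b)"
    using assms(1)
  proof (induction rule: set_run_induct)
    case Nil
    then show ?case using b by (simp add: penalty_eq_exp[OF b])
  next
    case (None h)
    then show ?case by (simp add: load_snoc charge_append charge_snoc)
  next
    case (Some h t ok)
    show ?case
    proof (cases "t = s")
      case False
      with Some show ?thesis by (simp add: load_snoc charge_append charge_snoc)
    next
      case True
      let ?p = "eprob G s (length h)" and ?l = "load G h s"
      have "(s, length h) \<in> edges G"
        using Some True assms(2) by (intro available_D(2) policy_available) auto
      then have p: "0 \<le> ?p" "?p \<le> 1" using edge_D by (auto intro: less_imp_le)
      have "?b * (penalty G s (?l + ?p) - penalty G s ?l) \<le> ?p * penalty G s (?l + ?p)"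
        by (rule penalty_increment[OF b p(1)])
      \<comment> \<open>The charge uses the old load, the increment bound the new one; this gap is
        the source of the 1/b loss.\<close>
      moreover have "penalty G s (?l + ?p) - penalty G s ?l \<le> 1 / ?b"
        using penalty_lipschitz[OF b p(1), of ?l] p b
        by (simp add: field_simps)
      then have "?p * (penalty G s (?l + ?p) - penalty G s ?l) \<le> ?p * (1 / ?b)"
        using p(1) by (rule mult_left_mono)
      ultimately show ?thesis
        using Some True by (simp add: load_snoc charge_append charge_snoc algebra_simps)
    qed
  qed
  then show ?thesis by blast
qed

end

section \<open>Dual feasibility for StochasticBalance\<close>

lemma stochastic_balance_feasible:
  "stochastic_balance G \<pi> \<Longrightarrow> feasible_policy G \<pi>"
  unfolding stochastic_balance_def feasible_policy_def
  by (fastforce simp: is_arg_max_def split: if_splits)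

locale balance_policy =
  fixes G :: bmatching and \<pi> :: policy
  assumes valid': "valid_instance G" and balance: "stochastic_balance G \<pi>"
begin

sublocale bmatching_policy G \<pi>
  using valid' balance by unfold_locales (auto intro: stochastic_balance_feasible)

text \<open>Server duals never decrease, and filling up only lifts them to their maximum. A dual
  constraint that holds on arrival of its request therefore keeps holding.\<close>

lemma server_dual_snoc_mono:
  assumes "s \<in> servers G" "length h < num_requests G"
    and "\<And>t ok. a = Some (t, ok) \<Longrightarrow> t \<in> available G h"
  shows "server_dual G h s \<le> server_dual G (h @ [a]) s"
proof -
  have b: "0 < capacity G s" using assms by (simp add: server_D)
  have "load G h s \<le> load G (h @ [a]) s"
    using assms(3) available_D(2) edge_D(3) by (fastforce simp: load_snoc)
  moreover have "successes h s \<le> successes (h @ [a]) s" by (simp add: successes_snoc)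
  ultimately show ?thesis
    using penalty_mono[OF b] penalty_le_1[OF b] by (simp add: server_dual_def)
qed

lemma request_dual_nonneg:
  assumes "\<And>s ok. h ! i = Some (s, ok) \<Longrightarrow> (s, i) \<in> edges G"
  shows "0 \<le> request_dual G h i"
  unfolding request_dual_def charge_def
  using assms by (intro sum_nonneg mult_nonneg_nonneg)
    (auto simp: server_D penalty_le_1 intro!: mult_nonneg_nonneg dest!: edge_D(3))

text \<open>If \<open>s\<close> is available when \<open>r\<close> arrives at load l, the greedy
  choice gives \<open>r\<close> at least w p (1 - f(l)), and the server term adds w p (f(l) - 1/e).
  If \<open>s\<close> is full, its own term suffices.\<close>

lemma dual_feasible:
  assumes "h \<in> set_pmf (run G \<pi> k)" "k \<le> num_requests G"
  shows "\<forall>(s, r)\<in>edges G. r < k \<longrightarrow>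
    (1 - exp (-1)) * (eprob G s r * weight G s)
      \<le> eprob G s r * weight G s * server_dual G h s + request_dual G h r"
proof -
  let ?P = "\<lambda>h. \<forall>(s, r)\<in>edges G. r < length h \<longrightarrow>
    (1 - exp (-1)) * (eprob G s r * weight G s)
      \<le> eprob G s r * weight G s * server_dual G h s + request_dual G h r"
  \<comment> \<open>One arrival, assigned or not; \<open>best\<close> is all that is used of the
    greedy rule.\<close>
  have step: "?P (h @ [a])"
    if IH: "?P h" and len: "length h < num_requests G"
      and a: "\<And>t ok. a = Some (t, ok) \<Longrightarrow> t \<in> available G h"
      and best: "\<And>s. s \<in> available G h \<Longrightarrow>
        weight G s * eprob G s (length h) * (1 - penalty G s (load G h s))
          \<le> request_dual G (h @ [a]) (length h)"
    for h a
  proof (intro ballI, clarify)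
    fix s r assume e: "(s, r) \<in> edges G" and r: "r < length (h @ [a])"
    have s: "s \<in> servers G" using e by (rule edge_D)
    have c: "0 \<le> eprob G s r * weight G s"
      using edge_D[OF e] server_D[OF s] by simp
    have mono: "server_dual G h s \<le> server_dual G (h @ [a]) s"
      by (rule server_dual_snoc_mono[OF s len a])
    note mono' = mult_left_mono[OF mono c]
    show "(1 - exp (-1)) * (eprob G s r * weight G s)
      \<le> eprob G s r * weight G s * server_dual G (h @ [a]) s + request_dual G (h @ [a]) r"
    proof (cases "r < length h")
      case True
      then have "request_dual G (h @ [a]) r = request_dual G h r"
        by (simp add: request_dual_def charge_append)
      with bspec[OF IH e] True mono' show ?thesis by simp
    next
      case False
      with r have r: "r = length h" by simp
      show ?thesis
      proof (cases "s \<in> available G h")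
        case True
        have "eprob G s r * weight G s * (penalty G s (load G h s) - exp (-1)) \<le>
            eprob G s r * weight G s * server_dual G h s"
          using available_D(3)[OF True] by (simp add: server_dual_def)
        with best[OF True] mono' show ?thesis
          by (simp add: r algebra_simps)
      next
        case False
        then have "capacity G s \<le> successes h s"
          using e r s by (auto simp: available_def)
        then have "server_dual G (h @ [a]) s = 1 - exp (-1)"
          by (simp add: server_dual_def successes_snoc)
        moreover have "0 \<le> request_dual G (h @ [a]) r"
          using a available_D(2) r by (intro request_dual_nonneg) auto
        ultimately show ?thesis by (simp add: mult.commute)
      qed
    qed
  qed
  have "length h = k \<and> ?P h"
    using assms(1)
  proof (induction rule: set_run_induct)
    case Nil
    then show ?case by simp
  next
    case (None h)
    have len: "length h < num_requests G" using None assms(2) by simp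
    \<comment> \<open>A request stays unassigned only without available neighbors, which makes
      \<open>best\<close> vacuous.\<close>
    then have "available G h = {}"
      using None(3) balance by (force simp: stochastic_balance_def split: if_splits)
    then show ?case using None len by (intro step) auto
  next
    case (Some h t ok)
    have len: "length h < num_requests G" using Some assms(2) by simp
    have t: "t \<in> available G h" by (rule policy_available[OF Some(3) len])
    have "available G h \<noteq> {}" using t by auto
    then have max: "is_arg_max
             (\<lambda>s. weight G s * eprob G s (length h) * (1 - penalty G s (load G h s)))
             (\<lambda>s. s \<in> available G h) t"
      using balance[unfolded stochastic_balance_def, rule_format, OF len] Some(3) by auto
    have "request_dual G (h @ [Some (t, ok)]) (length h) =
        (\<Sum>s\<in>servers G. if s = t then
           weight G t * eprob G t (length h) * (1 - penalty G t (load G h t)) else 0)"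
      unfolding request_dual_def by (intro sum.cong) (auto simp: charge_snoc)
    also have "\<dots> = weight G t * eprob G t (length h) * (1 - penalty G t (load G h t))"
      using available_D(1)[OF t] by simp
    finally have rd: "request_dual G (h @ [Some (t, ok)]) (length h) = \<dots>" .
    show ?case
      using Some(2) len t max unfolding is_arg_max_linorder by (intro step) (auto simp: rd)
  qed
  then show ?thesis by auto
qed

section \<open>Weak duality and the expected dual cost\<close>

text \<open>The dual constraints are weighted by \<open>m\<close> and summed over edges; the LP
  constraints on \<open>m\<close> then bound the coefficients of the nonnegative duals. The cost is
  sorted by server, to be compared with loads.\<close>

lemma weak_duality:
  assumes h: "h \<in> set_pmf (run G \<pi> (num_requests G))" and m: "lp_feasible G m"
  shows "(1 - exp (-1)) * lp_objective G m \<le>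
    (\<Sum>s\<in>servers G. weight G s *
       (real (capacity G s) * server_dual G h s + (\<Sum>i<length h. charge G h s i)))"
proof -
  let ?n = "num_requests G"
  have len: "length h = ?n" using h by (rule length_run)
  have dual_nonneg: "0 \<le> server_dual G h s" if "s \<in> servers G" for s
  proof -
    have "exp (-1) = penalty G s 0" using that by (simp add: penalty_eq_exp server_D)
    moreover have "0 \<le> load G h s"
      unfolding load_eq_sum using run_edges[OF h] edge_D(3)
      by (intro sum_nonneg) (auto intro!: less_imp_le)
    ultimately show ?thesis
      using penalty_mono[of G s 0 "load G h s"] penalty_le_1[of G s 0] server_D[OF that]
      by (auto simp: server_dual_def)
  qed
  have "(1 - exp (-1)) * lp_objective G m =
      (\<Sum>(s, r)\<in>edges G. (1 - exp (-1)) * (eprob G s r * weight G s) * m s r)"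
    by (simp add: lp_objective_def sum_distrib_left mult_ac case_prod_unfold)
  also have "\<dots> \<le> (\<Sum>(s, r)\<in>edges G.
      (eprob G s r * weight G s * server_dual G h s + request_dual G h r) * m s r)"
  proof (intro sum_mono, clarify)
    fix s r assume e: "(s, r) \<in> edges G"
    have "0 \<le> m s r" using m e by (auto simp: lp_feasible_def)
    with bspec[OF dual_feasible[OF h order_refl] e] edge_D(2)[OF e]
    show "(1 - exp (-1)) * (eprob G s r * weight G s) * m s r \<le>
        (eprob G s r * weight G s * server_dual G h s + request_dual G h r) * m s r"
      by (intro mult_right_mono) auto
  qed
  also have "\<dots> = (\<Sum>(s, r)\<in>edges G. eprob G s r * weight G s * (server_dual G h s * m s r)) +
      (\<Sum>(s, r)\<in>edges G. request_dual G h r * m s r)"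
    by (simp add: sum.distrib case_prod_unfold algebra_simps)
  also have "(\<Sum>(s, r)\<in>edges G. eprob G s r * weight G s * (server_dual G h s * m s r)) =
      (\<Sum>s\<in>servers G. weight G s * server_dual G h s * (\<Sum>r | (s, r) \<in> edges G. eprob G s r * m s r))"
    \<comment> \<open>Regrouping by server is the objective identity at the rescaled
      \<open>server_dual G h s * m s r\<close>.\<close>
    using lp_objective_eq[of "\<lambda>s r. server_dual G h s * m s r"]
    by (simp add: lp_objective_def sum_distrib_left mult_ac)
  also have "\<dots> \<le> (\<Sum>s\<in>servers G. weight G s * server_dual G h s * real (capacity G s))"
    using m dual_nonneg by (intro sum_mono mult_left_mono) (auto simp: lp_feasible_def server_D)
  also have "(\<Sum>(s, r)\<in>edges G. request_dual G h r * m s r) =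
      (\<Sum>r<?n. request_dual G h r * (\<Sum>s | (s, r) \<in> edges G. m s r))"
  proof -
    have "(\<Sum>(s, r)\<in>edges G. request_dual G h r * m s r) =
       (\<Sum>r<?n. \<Sum>(s, r')\<in>{e\<in>edges G. snd e = r}. request_dual G h r' * m s r')"
      by (rule sum.group[symmetric]) (auto dest: edge_D)
    also have "\<dots> = (\<Sum>r<?n. \<Sum>s | (s, r) \<in> edges G. request_dual G h r * m s r)"
      by (intro sum.cong refl sum.reindex_bij_witness[of _ "\<lambda>s. (s, _)" fst]) auto
    finally show ?thesis by (simp add: sum_distrib_left)
  qed
  also have "\<dots> \<le> (\<Sum>r<?n. request_dual G h r * 1)"
    using m run_edges[OF h] len
    by (intro sum_mono mult_left_mono request_dual_nonneg) (auto simp: lp_feasible_def)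
  also have "\<dots> = (\<Sum>s\<in>servers G. weight G s * (\<Sum>i<length h. charge G h s i))"
    unfolding request_dual_def len by (simp add: sum.swap[of _ "servers G"] sum_distrib_left)
  finally show ?thesis
    by (simp add: sum.distrib algebra_simps)
qed

text \<open>
  A full server is charged \<open>b (1 - f L) \<le> \<bar>X - L\<bar>\<close> beyond its potential, where \<open>X\<close> counts its
  successes and \<open>L\<close> is its load. By AM-GM this is at most \<open>((X - L)\<^sup>2 + b) / (2 sqrt b)\<close>, and \<open>b = X\<close>
  makes the error proportional to the number of successes, even when \<open>X\<close> is small in expectation.
\<close>

lemma server_cost:
  assumes h: "h \<in> set_pmf (run G \<pi> (num_requests G))" and s: "s \<in> servers G"
  shows "real (capacity G s) * server_dual G h s + (\<Sum>i<length h. charge G h s i)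
    \<le> load G h s * (1 + 1 / real (capacity G s)) +
       ((real (successes h s) - load G h s)\<^sup>2 + real (successes h s)) / (2 * sqrt (real (capacity G s)))"
proof -
  let ?b = "real (capacity G s)" and ?X = "real (successes h s)" and ?L = "load G h s"
  have b: "0 < capacity G s" using s by (rule server_D)
  note pot = server_potential[OF h order_refl s]
  show ?thesis
  proof (cases "capacity G s \<le> successes h s")
    case False
    have "0 \<le> ((?X - ?L)\<^sup>2 + ?X) / (2 * sqrt ?b)" by simp
    with pot have "?b * (penalty G s ?L - exp (-1)) + (\<Sum>i<length h. charge G h s i)
        \<le> ?L * (1 + 1 / ?b) + ((?X - ?L)\<^sup>2 + ?X) / (2 * sqrt ?b)" by linarith
    with False show ?thesis by (simp only: server_dual_def if_False)
  next
    case True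
    have "?b * (1 - penalty G s ?L) \<le> \<bar>?X - ?L\<bar>"
    proof (cases "?L \<le> ?b")
      case le: True
      \<comment> \<open>As f(b) = 1, the Lipschitz bound between L and b gives b (1 - f(L)) \<le> b
        - L, and a full server has b \<le> X.\<close>
      have "penalty G s ?b = 1" using b by (simp add: penalty_def)
      then show ?thesis
        using penalty_lipschitz[OF b, of "?b - ?L" ?L] le True by simp
    qed (simp add: penalty_def)
    also have "\<dots> \<le> ((?X - ?L)\<^sup>2 + ?b) / (2 * sqrt ?b)"
    proof -
      have "0 \<le> (\<bar>?X - ?L\<bar> - sqrt ?b)\<^sup>2" by simp
      then have "\<bar>?X - ?L\<bar> * (2 * sqrt ?b) \<le> (?X - ?L)\<^sup>2 + ?b"
        by (simp add: power2_diff)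
      then show ?thesis using b by (subst pos_le_divide_eq) auto
    qed
    also have "\<dots> \<le> ((?X - ?L)\<^sup>2 + ?X) / (2 * sqrt ?b)"
      using True by (intro divide_right_mono) auto
    finally show ?thesis
      using pot True by (simp add: server_dual_def algebra_simps)
  qed
qed

text \<open>In expectation both errors of a server are multiples of its expected successes. The loss
  is thus a factor that depends only on \<open>B\<close>, whatever the weights and the number of
  servers.\<close>

lemma expected_weight_ge_lp_objective:
  assumes m: "lp_feasible G m" and B: "0 < B" "B \<le> b_min G"
  shows "(1 - exp (-1)) * lp_objective G m \<le> (1 + 2 / sqrt (real B)) * expected_weight G \<pi>"
proof -
  let ?X = "\<lambda>s h. real (successes h s)" and ?L = "\<lambda>s h. load G h s" and ?b = "\<lambda>s. real (capacity G s)"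
  let ?C = "\<lambda>s h. ?L s h * (1 + 1 / ?b s) + ((?X s h - ?L s h)\<^sup>2 + ?X s h) / (2 * sqrt (?b s))"
  have "(1 - exp (-1)) * lp_objective G m = E (\<lambda>h. (1 - exp (-1)) * lp_objective G m)"
    by simp
  also have "\<dots> \<le> E (\<lambda>h. \<Sum>s\<in>servers G. weight G s * ?C s h)"
  proof (intro integral_mono_AE AE_pmfI)
    fix h assume h: "h \<in> set_pmf (run G \<pi> (num_requests G))"
    show "(1 - exp (-1)) * lp_objective G m \<le> (\<Sum>s\<in>servers G. weight G s * ?C s h)"
      by (rule order_trans[OF weak_duality[OF h m]])
         (intro sum_mono mult_left_mono server_cost[OF h] server_D)
  qed auto
  also have "\<dots> = (\<Sum>s\<in>servers G. weight G s * E (?C s))"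
    by simp
  also have "\<dots> \<le> (\<Sum>s\<in>servers G. weight G s * ((1 + 2 / sqrt (real B)) * E (?X s)))"
  proof (intro sum_mono mult_left_mono)
    fix s assume s: "s \<in> servers G"
    have "b_min G \<le> capacity G s" using s by (simp add: b_min_def)
    then have Bb: "real B \<le> ?b s" using B by simp
    have b1: "1 \<le> ?b s" using Bb B by simp
    have EX: "0 \<le> E (?X s)" by (intro Bochner_Integration.integral_nonneg) simp
    have "E (?C s) = E (?X s) * (1 + 1 / ?b s) +
        (E (\<lambda>h. (?X s h - ?L s h)\<^sup>2) + E (?X s)) / (2 * sqrt (?b s))"
      by (simp add: expectation_load)
    also have "\<dots> \<le> E (?X s) * (1 + 1 / ?b s) + (E (?X s) + E (?X s)) / (2 * sqrt (?b s))"
      by (intro add_left_mono divide_right_mono add_right_mono expectation_deviation) simp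
    also have "\<dots> = E (?X s) * (1 + 1 / ?b s + 1 / sqrt (?b s))"
      by (simp add: algebra_simps)
    also have "\<dots> \<le> E (?X s) * (1 + 2 / sqrt (real B))"
    proof (intro mult_left_mono EX)
      \<comment> \<open>Since b \<ge> 1, the term 1/b is absorbed by 1/sqrt b, which explains the
        constant 2.\<close>
      have "sqrt (?b s) * 1 \<le> sqrt (?b s) * sqrt (?b s)"
        using b1 by (intro mult_left_mono) auto
      then have "sqrt (?b s) \<le> ?b s" using b1 by simp
      then have "1 / ?b s \<le> 1 / sqrt (?b s)"
        using b1 by (intro divide_left_mono) auto
      moreover have "1 / sqrt (?b s) \<le> 1 / sqrt (real B)"
        using Bb B b1 by (intro divide_left_mono) auto
      ultimately show "1 + 1 / ?b s + 1 / sqrt (?b s) \<le> 1 + 2 / sqrt (real B)" by simp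
    qed
    finally show "E (?C s) \<le> (1 + 2 / sqrt (real B)) * E (?X s)" by (simp add: mult.commute)
  qed (rule server_D)
  also have "\<dots> = (1 + 2 / sqrt (real B)) * expected_weight G \<pi>"
    by (simp add: expected_weight_eq sum_distrib_left mult_ac)
  finally show ?thesis .
qed

end

section \<open>Comparison of the benchmarks and the competitive ratio\<close>

lemma lp_feasible_zero: "lp_feasible G (\<lambda>_ _. 0)"
  by (simp add: lp_feasible_def)

text \<open>Shows that \<open>SOpt\<close> is a supremum over a nonempty set, and gives access to
  the locale for facts about the instance alone.\<close>

lemma feasible_policy_None: "feasible_policy G (\<lambda>_. return_pmf None)"
  by (simp add: feasible_policy_def)

lemma bdd_above_lp_objective:
  assumes "valid_instance G"
  shows "bdd_above (lp_objective G ` {m. lp_feasible G m})"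
proof -
  interpret bmatching_policy G "\<lambda>_. return_pmf None"
    using assms feasible_policy_None by unfold_locales
  show ?thesis using lp_objective_le by (auto simp: bdd_above_def)
qed

lemma Opt_nonneg:
  assumes "valid_instance G"
  shows "0 \<le> Opt G"
  unfolding Opt_def
  by (rule cSUP_upper2[OF bdd_above_lp_objective[OF assms], of "\<lambda>_ _. 0"])
     (auto simp: lp_feasible_zero lp_objective_def)

lemma expected_weight_le_Opt:
  assumes "valid_instance G" "feasible_policy G \<pi>"
  shows "expected_weight G \<pi> \<le> Opt G"
proof -
  interpret bmatching_policy G \<pi> using assms by unfold_locales
  obtain m where "lp_feasible G m" "lp_objective G m = expected_weight G \<pi>"
    using lp_solution_of_policy by blast
  then show ?thesis
    unfolding Opt_def
    by (intro cSUP_upper2[OF bdd_above_lp_objective[OF assms(1)], of m]) auto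
qed

lemma SOpt_le_Opt:
  assumes "valid_instance G"
  shows "SOpt G \<le> Opt G"
  unfolding SOpt_def
  using feasible_policy_None by (intro cSUP_least) (auto intro: expected_weight_le_Opt[OF assms])

lemma SOpt_nonneg:
  assumes "valid_instance G"
  shows "0 \<le> SOpt G"
proof -
  interpret bmatching_policy G "\<lambda>_. return_pmf None"
    using assms feasible_policy_None by unfold_locales
  have "bdd_above (expected_weight G ` {\<pi>. feasible_policy G \<pi>})"
    using expected_weight_le_Opt[OF assms] by (auto simp: bdd_above_def)
  then have "expected_weight G (\<lambda>_. return_pmf None) \<le> SOpt G"
    unfolding SOpt_def by (intro cSUP_upper) (simp_all add: feasible_policy_None)
  with expected_weight_nonneg show ?thesis by linarith
qed

theorem theorem3p2:
  fixes \<epsilon> :: real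
  assumes "\<epsilon> > 0"
  shows "\<exists>b\<^sub>0 :: nat. \<forall>G :: bmatching. valid_instance G \<longrightarrow> b_min G \<ge> b\<^sub>0 \<longrightarrow>
           (\<forall>\<pi> :: policy. stochastic_balance G \<pi> \<longrightarrow>
              expected_weight G \<pi> \<ge> (1 - 1 / exp 1 - \<epsilon>) * Opt G \<and>
              expected_weight G \<pi> \<ge> (1 - 1 / exp 1 - \<epsilon>) * SOpt G)"
proof -
  define c where "c = 1 - 1 / exp 1 - \<epsilon>"
  have c_eq: "1 - exp (-1) = c + \<epsilon>" by (simp add: c_def exp_minus inverse_eq_divide)
  \<comment> \<open>Chosen so that the loss 2 / sqrt B is at most \<epsilon>.\<close>
  obtain B :: nat where B: "(2 / \<epsilon>)\<^sup>2 < real B" using reals_Archimedean2 by blast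
  have B0: "0 < B" using B by (cases B) (auto simp: not_less)
  have "2 / \<epsilon> < sqrt (real B)" using B by (rule real_less_rsqrt)
  then have B\<epsilon>: "2 / sqrt (real B) \<le> \<epsilon>" using assms B0 by (simp add: field_simps)
  have "c * Opt G \<le> expected_weight G \<pi> \<and> c * SOpt G \<le> expected_weight G \<pi>"
    if G: "valid_instance G" "B \<le> b_min G" and \<pi>: "stochastic_balance G \<pi>" for G \<pi>
  proof -
    interpret balance_policy G \<pi> using G \<pi> by unfold_locales
    show ?thesis
    \<comment> \<open>For large \<epsilon> the ratio \<open>c\<close> is not positive and both
      bounds are trivial; the other case multiplies inequalities by \<open>c\<close>.\<close>
    proof (cases "0 < c")
      case False
      then have "c * Opt G \<le> 0" "c * SOpt G \<le> 0"
        using Opt_nonneg[OF G(1)] SOpt_nonneg[OF G(1)] by (auto intro: mult_nonpos_nonneg)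
      with expected_weight_nonneg show ?thesis by linarith
    next
      case True
      \<comment> \<open>Solved for the objective, so that the supremum over \<open>m\<close> can be
        taken.\<close>
      have "lp_objective G m \<le> expected_weight G \<pi> * (1 + \<epsilon>) / (c + \<epsilon>)" if "lp_feasible G m" for m
      proof -
        have "(c + \<epsilon>) * lp_objective G m \<le> (1 + 2 / sqrt (real B)) * expected_weight G \<pi>"
          using expected_weight_ge_lp_objective[OF that B0 G(2)] by (simp add: c_eq)
        also have "\<dots> \<le> (1 + \<epsilon>) * expected_weight G \<pi>"
          using B\<epsilon> expected_weight_nonneg by (intro mult_right_mono) auto
        finally show ?thesis using True assms by (simp add: field_simps)
      qed
      then have "Opt G \<le> expected_weight G \<pi> * (1 + \<epsilon>) / (c + \<epsilon>)"
        unfolding Opt_def using lp_feasible_zero by (intro cSUP_least) auto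
      then have ALG: "(c + \<epsilon>) * Opt G \<le> (1 + \<epsilon>) * expected_weight G \<pi>"
        using True assms by (simp add: field_simps)
      have "c \<le> 1" using c_eq exp_gt_zero[of "-1 :: real"] assms by linarith
      \<comment> \<open>The factor 1 + \<epsilon> costs at most an additive \<epsilon> in the ratio,
        because \<open>c\<close> is at most 1.\<close>
      then have "c * (1 + \<epsilon>) \<le> c + \<epsilon>"
        using assms by (simp add: algebra_simps mult_left_le_one_le mult_le_cancel_right1)
      then have "c * (1 + \<epsilon>) * Opt G \<le> (c + \<epsilon>) * Opt G"
        using Opt_nonneg[OF G(1)] by (rule mult_right_mono)
      with ALG have "(1 + \<epsilon>) * (c * Opt G) \<le> (1 + \<epsilon>) * expected_weight G \<pi>"
        by (simp add: algebra_simps)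
      then have "c * Opt G \<le> expected_weight G \<pi>"
        using assms by simp
      moreover have "c * SOpt G \<le> c * Opt G"
        using True SOpt_le_Opt[OF G(1)] by simp
      ultimately show ?thesis by simp
    qed
  qed
  then show ?thesis unfolding c_def by blast
qed

end
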